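(* Let $R$ be a semihyperring. The following conditions are equivalent: (1) $R$ is fully idempotent; (2) the set of all fuzzy hyperideals of $R$, ordered by $\leq$, is a distributive lattice under the sum $\oplus$ (as join) and the intersection $\wedge$ (as meet) of fuzzy hyperideals, and $\lambda\wedge\mu=\lambda\mu$ for each pair of fuzzy hyperideals $\lambda,\mu$ of $R$; (3) each fuzzy hyperideal of $R$ is the intersection (pointwise infimum) of those fuzzy prime hyperideals of $R$ which contain it. If, in addition, $R$ is assumed to be commutative (that is, $xy=yx$ for all $x,y\in R$), then conditions (1), (2) and (3) are equivalent to: (4) $R$ is regular.
   Context: A commutative semihypergroup is a non-empty set $R$ with a map $\oplus$ from $R\times R$ to the non-empty subsets of $R$ which is commutative and associative, where $A\oplus B=\bigcup_{a\in A,b\in B}a\oplus b$ for subsets and an element is identified with its singleton when convenient. A semihyperring $(R,\oplus,\cdot)$ is a non-empty set $R$ such that $(R,\oplus)$ is a commutative semihypergroup, $(R,\cdot)$ is a semigroup, $x(y\oplus z)=xy\oplus xz$ and $(x\oplus y)z=xz\oplus yz$ for all $x,y,z\in R$ (equality of sets), and there is an element $0\in R$ with $0\oplus x=x\oplus 0=\{x\}$ and $0x=x0=0$ for all $x\in R$. No multiplicative identity is assumed. A hyperideal of $R$ is a non-empty subset $I\subseteq R$ with $x\oplus y\subseteq I$ for $x,y\in I$ and $rx,xr\in I$ for $r\in R$, $x\in I$. For hyperideals $I,J$, the product $IJ$ is the set of all elements lying in some finite hypersum $a_1b_1\oplus\cdots\oplus a_pb_p$ with $a_i\in I$, $b_i\in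 J$, $p\ge 1$. $R$ is fully idempotent if $I^2=I$ for every hyperideal $I$ of $R$. $R$ is regular if for each $x\in R$ there is $a\in R$ with $x=xax$. A fuzzy subset of $R$ is a function $\mu:R\to[0,1]$. $\lambda\leq\mu$ ("$\mu$ contains $\lambda$") means $\lambda(x)\leq\mu(x)$ for all $x$. $\wedge$ and $\vee$ denote (pointwise) infimum and supremum; the supremum of the empty set is $0$. A fuzzy hyperideal of $R$ is a fuzzy subset $\mu$ with $\mu(0)=1$, $\inf_{z\in x\oplus y}\mu(z)\geq\mu(x)\wedge\mu(y)$, $\mu(xy)\geq\mu(x)$ and $\mu(yx)\geq\mu(x)$ for all $x,y\in R$. For fuzzy hyperideals $\lambda,\mu$, the sum and product are the fuzzy subsets $$(\lambda\oplus\mu)(x)=\bigvee_{x\in y\oplus z}[\lambda(y)\wedge\mu(z)],\qquad (\lambda\mu)(x)=\bigvee_{x\in y_1z_1\oplus\cdots\oplus y_pz_p}\ \bigwedge_{1\le i\le p}[\lambda(y_i)\wedge\mu(z_i)],$$ the second supremum being over all $p\ge 1$ and all $y_i,z_i\in R$ with $x\in y_1z_1\oplus\cdots\oplus y_pz_p$. A fuzzy hyperideal $\eta$ is fuzzy prime if for all fuzzy hyperideals $\lambda,\mu$ of $R$, $\lambda\mu\leq\eta$ implies $\lambda\leq\eta$ or $\mu\leq\eta$ (properness is not required). *)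

theory Defs
  imports Complex_Main "HOL-Library.FuncSet" "HOL-Algebra.Lattice"
begin

record 'a hyperstructure = "'a partial_object" +
  hadd :: "'a \<Rightarrow> 'a \<Rightarrow> 'a set"  (infixl \<open>\<boxplus>\<index>\<close> 65)
  hmult :: "'a \<Rightarrow> 'a \<Rightarrow> 'a"  (infixl \<open>\<boxdot>\<index>\<close> 70)
  hzero :: 'a

definition set_hadd :: "('a, 'b) hyperstructure_scheme \<Rightarrow> 'a set \<Rightarrow> 'a set \<Rightarrow> 'a set" where
  "set_hadd R A B = (\<Union>a\<in>A. \<Union>b\<in>B. a \<boxplus>\<^bsub>R\<^esub> b)"

locale comm_semihypergroup =
  fixes R :: "('a, 'b) hyperstructure_scheme" (structure)
  assumes carrier_nonempty: "carrier R \<noteq> {}"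
    and hadd_closed: "\<lbrakk>x \<in> carrier R; y \<in> carrier R\<rbrakk> \<Longrightarrow> x \<boxplus> y \<subseteq> carrier R"
    and hadd_nonempty: "\<lbrakk>x \<in> carrier R; y \<in> carrier R\<rbrakk> \<Longrightarrow> x \<boxplus> y \<noteq> {}"
    and hadd_commute: "\<lbrakk>x \<in> carrier R; y \<in> carrier R\<rbrakk> \<Longrightarrow> x \<boxplus> y = y \<boxplus> x"
    and hadd_assoc: "\<lbrakk>x \<in> carrier R; y \<in> carrier R; z \<in> carrier R\<rbrakk>
      \<Longrightarrow> set_hadd R (x \<boxplus> y) {z} = set_hadd R {x} (y \<boxplus> z)"

locale semihyperring = comm_semihypergroup +
  assumes hmult_closed: "\<lbrakk>x \<in> carrier R; y \<in> carrier R\<rbrakk> \<Longrightarrow> x \<boxdot> y \<in> carrier R"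
    and hmult_assoc: "\<lbrakk>x \<in> carrier R; y \<in> carrier R; z \<in> carrier R\<rbrakk>
      \<Longrightarrow> (x \<boxdot> y) \<boxdot> z = x \<boxdot> (y \<boxdot> z)"
    and distrib_left: "\<lbrakk>x \<in> carrier R; y \<in> carrier R; z \<in> carrier R\<rbrakk>
      \<Longrightarrow> (\<lambda>u. x \<boxdot> u) ` (y \<boxplus> z) = (x \<boxdot> y) \<boxplus> (x \<boxdot> z)"
    and distrib_right: "\<lbrakk>x \<in> carrier R; y \<in> carrier R; z \<in> carrier R\<rbrakk>
      \<Longrightarrow> (\<lambda>u. u \<boxdot> z) ` (x \<boxplus> y) = (x \<boxdot> z) \<boxplus> (y \<boxdot> z)"
    and zero_closed: "hzero R \<in> carrier R"
    and zero_hadd: "x \<in> carrier R \<Longrightarrow> hzero R \<boxplus> x = {x}"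
    and hadd_zero: "x \<in> carrier R \<Longrightarrow> x \<boxplus> hzero R = {x}"
    and zero_hmult: "x \<in> carrier R \<Longrightarrow> hzero R \<boxdot> x = hzero R"
    and hmult_zero: "x \<in> carrier R \<Longrightarrow> x \<boxdot> hzero R = hzero R"

definition hcommutative :: "('a, 'b) hyperstructure_scheme \<Rightarrow> bool" where
  "hcommutative R \<longleftrightarrow> (\<forall>x\<in>carrier R. \<forall>y\<in>carrier R. x \<boxdot>\<^bsub>R\<^esub> y = y \<boxdot>\<^bsub>R\<^esub> x)"

definition hregular :: "('a, 'b) hyperstructure_scheme \<Rightarrow> bool" where
  "hregular R \<longleftrightarrow> (\<forall>x\<in>carrier R. \<exists>a\<in>carrier R. x = x \<boxdot>\<^bsub>R\<^esub> a \<boxdot>\<^bsub>R\<^esub> x)"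

text \<open>The hypersum of a list. The empty list is given the value of the neutral element,
  so that in a semihyperring a one-element list has hypersum the singleton of its entry.
  The products below only use nonempty lists.\<close>

primrec hypersum :: "('a, 'b) hyperstructure_scheme \<Rightarrow> 'a list \<Rightarrow> 'a set" where
  "hypersum R [] = {hzero R}"
| "hypersum R (x # xs) = set_hadd R {x} (hypersum R xs)"

definition sum_of_products :: "('a, 'b) hyperstructure_scheme \<Rightarrow> ('a \<times> 'a) list \<Rightarrow> 'a set" where
  "sum_of_products R ps = hypersum R (map (\<lambda>(a, b). a \<boxdot>\<^bsub>R\<^esub> b) ps)"

definition hyperideal :: "('a, 'b) hyperstructure_scheme \<Rightarrow> 'a set \<Rightarrow> bool" where
  "hyperideal R I \<longleftrightarrow> I \<noteq> {} \<and> I \<subseteq> carrier R \<and>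
     (\<forall>x\<in>I. \<forall>y\<in>I. x \<boxplus>\<^bsub>R\<^esub> y \<subseteq> I) \<and>
     (\<forall>r\<in>carrier R. \<forall>x\<in>I. r \<boxdot>\<^bsub>R\<^esub> x \<in> I \<and> x \<boxdot>\<^bsub>R\<^esub> r \<in> I)"

definition hyperideal_prod :: "('a, 'b) hyperstructure_scheme \<Rightarrow> 'a set \<Rightarrow> 'a set \<Rightarrow> 'a set" where
  "hyperideal_prod R I J =
     {x. \<exists>ps. ps \<noteq> [] \<and> set ps \<subseteq> I \<times> J \<and> x \<in> sum_of_products R ps}"

definition fully_idempotent :: "('a, 'b) hyperstructure_scheme \<Rightarrow> bool" where
  "fully_idempotent R \<longleftrightarrow> (\<forall>I. hyperideal R I \<longrightarrow> hyperideal_prod R I I = I)"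

text \<open>Fuzzy subsets are extensional functions on the carrier, so that HOL equality of
  fuzzy subsets is equality of functions defined on the carrier.\<close>

definition fuzzy_subsets :: "('a, 'b) hyperstructure_scheme \<Rightarrow> ('a \<Rightarrow> real) set" where
  "fuzzy_subsets R = carrier R \<rightarrow>\<^sub>E {0..1}"

definition fuzzy_le :: "('a, 'b) hyperstructure_scheme \<Rightarrow> ('a \<Rightarrow> real) \<Rightarrow> ('a \<Rightarrow> real) \<Rightarrow> bool" where
  "fuzzy_le R l m \<longleftrightarrow> (\<forall>x\<in>carrier R. l x \<le> m x)"

text \<open>Supremum in the unit interval. The convention for the empty set is explicit,
  since the supremum of the empty set of reals is an unspecified value.\<close>

definition unit_Sup :: "real set \<Rightarrow> real" where
  "unit_Sup S = (if S = {} then 0 else Sup S)"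

definition fuzzy_hyperideal :: "('a, 'b) hyperstructure_scheme \<Rightarrow> ('a \<Rightarrow> real) \<Rightarrow> bool" where
  "fuzzy_hyperideal R m \<longleftrightarrow> m \<in> fuzzy_subsets R \<and> m (hzero R) = 1 \<and>
     (\<forall>x\<in>carrier R. \<forall>y\<in>carrier R.
        (INF z\<in>x \<boxplus>\<^bsub>R\<^esub> y. m z) \<ge> min (m x) (m y) \<and>
        m (x \<boxdot>\<^bsub>R\<^esub> y) \<ge> m x \<and> m (y \<boxdot>\<^bsub>R\<^esub> x) \<ge> m x)"

definition fuzzy_meet ::
    "('a, 'b) hyperstructure_scheme \<Rightarrow> ('a \<Rightarrow> real) \<Rightarrow> ('a \<Rightarrow> real) \<Rightarrow> 'a \<Rightarrow> real" where
  "fuzzy_meet R l m = (\<lambda>x\<in>carrier R. min (l x) (m x))"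

definition fuzzy_sum ::
    "('a, 'b) hyperstructure_scheme \<Rightarrow> ('a \<Rightarrow> real) \<Rightarrow> ('a \<Rightarrow> real) \<Rightarrow> 'a \<Rightarrow> real" where
  "fuzzy_sum R l m = (\<lambda>x\<in>carrier R.
     unit_Sup {min (l y) (m z) |y z. y \<in> carrier R \<and> z \<in> carrier R \<and> x \<in> y \<boxplus>\<^bsub>R\<^esub> z})"

definition fuzzy_prod ::
    "('a, 'b) hyperstructure_scheme \<Rightarrow> ('a \<Rightarrow> real) \<Rightarrow> ('a \<Rightarrow> real) \<Rightarrow> 'a \<Rightarrow> real" where
  "fuzzy_prod R l m = (\<lambda>x\<in>carrier R.
     unit_Sup {Min ((\<lambda>(y, z). min (l y) (m z)) ` set ps) |ps.
       ps \<noteq> [] \<and> set ps \<subseteq> carrier R \<times> carrier R \<and> x \<in> sum_of_products R ps})"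

definition fuzzy_prime :: "('a, 'b) hyperstructure_scheme \<Rightarrow> ('a \<Rightarrow> real) \<Rightarrow> bool" where
  "fuzzy_prime R e \<longleftrightarrow> fuzzy_hyperideal R e \<and>
     (\<forall>l m. fuzzy_hyperideal R l \<and> fuzzy_hyperideal R m \<and> fuzzy_le R (fuzzy_prod R l m) e
        \<longrightarrow> fuzzy_le R l e \<or> fuzzy_le R m e)"

text \<open>Pointwise infimum of a family of fuzzy subsets, meant for nonempty families; the
  family of all fuzzy primes containing a given fuzzy hyperideal is never empty, because
  the constant function 1 belongs to it.\<close>

definition fuzzy_Inter ::
    "('a, 'b) hyperstructure_scheme \<Rightarrow> ('a \<Rightarrow> real) set \<Rightarrow> 'a \<Rightarrow> real" where
  "fuzzy_Inter R F = (\<lambda>x\<in>carrier R. INF e\<in>F. e x)"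

definition fuzzy_hyperideal_order ::
    "('a, 'b) hyperstructure_scheme \<Rightarrow> ('a \<Rightarrow> real) gorder" where
  "fuzzy_hyperideal_order R =
     \<lparr>carrier = {m. fuzzy_hyperideal R m}, eq = (=), le = fuzzy_le R\<rparr>"

locale distributive_lattice = lattice +
  assumes meet_join_distrib: "\<lbrakk>x \<in> carrier L; y \<in> carrier L; z \<in> carrier L\<rbrakk>
    \<Longrightarrow> x \<sqinter> (y \<squnion> z) = (x \<sqinter> y) \<squnion> (x \<sqinter> z)"

end

theory Submission
  imports Defs
begin

text \<open>
  The idea is to replace a fuzzy subset \<open>m\<close> by the family of its strict level sets
  \<open>{x. t < m x}\<close> for \<open>0 \<le> t < 1\<close>, here called \<^emph>\<open>cuts\<close>. Strict inequalities are the right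
  choice because \<open>t < Sup S\<close> holds exactly when some element of \<open>S\<close> exceeds \<open>t\<close>, whether or
  not the supremum is attained. Consequently the cuts turn every fuzzy notion into the crisp
  one: \<open>m\<close> is a fuzzy hyperideal iff all its cuts are hyperideals
  (\<open>fuzzy_hyperideal_iff_cuts\<close>), the cut of a fuzzy sum, meet or product is the sum,
  intersection or product of the cuts (\<open>cut_fuzzy_sum\<close>, \<open>cut_fuzzy_meet\<close>, \<open>cut_fuzzy_prod\<close>),
  and \<open>l \<le> m\<close> means inclusion of all cuts. In the other direction a hyperideal \<open>I\<close> is every
  cut of its characteristic function. What remains is a statement about hyperideals.

  In a fully idempotent semihyperring \<open>I \<inter> J = IJ\<close>, since
  \<open>I \<inter> J = (I \<inter> J)(I \<inter> J) \<subseteq> IJ\<close>. As products distribute over sums, so do intersections;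
  this gives the distributive lattice of fuzzy hyperideals. Conversely, \<open>I \<inter> I = II\<close> is
  idempotency.

  For the intersection of primes, let \<open>a\<close> be an element with \<open>t = m a < 1\<close>. The cut of
  \<open>m\<close> at \<open>t\<close> is a hyperideal without \<open>a\<close>; a hyperideal \<open>P\<close> containing this cut and maximal
  among those without \<open>a\<close> is prime, because two hyperideals not contained in \<open>P\<close> have sums
  with \<open>P\<close> that both contain \<open>a\<close>; the product of these sums, which is their intersection,
  contains \<open>a\<close> as well, whereas it would lie in \<open>P\<close> if the product of the two hyperideals did.
  The function with value \<open>1\<close> on \<open>P\<close> and \<open>t\<close> elsewhere is then fuzzy
  prime, lies above \<open>m\<close>, and equals \<open>m\<close> at \<open>a\<close>. Conversely, any fuzzy prime above the
  characteristic function of \<open>II\<close> lies above that of \<open>I\<close>, so \<open>I \<subseteq> II\<close> if that function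
  is an intersection of primes.

  If \<open>R\<close> is regular, then \<open>x = (xa)x\<close> shows \<open>I \<subseteq> II\<close>. For commutative \<open>R\<close> the converse is
  obtained from the hyperideal of all \<open>y\<close> with \<open>Ry \<subseteq> Rx\<close>. It contains \<open>x\<close>, which \<open>Rx\<close> itself
  need not do without an identity, and idempotency shows that it lies in \<open>Rx\<close>.
\<close>

section \<open>Sums and products of hyperideals\<close>

definition hyperprime :: "('a, 'b) hyperstructure_scheme \<Rightarrow> 'a set \<Rightarrow> bool" where
  "hyperprime R P \<longleftrightarrow> hyperideal R P \<and>
     (\<forall>I J. hyperideal R I \<and> hyperideal R J \<and> hyperideal_prod R I J \<subseteq> P \<longrightarrow> I \<subseteq> P \<or> J \<subseteq> P)"

lemma set_hadd_mono: "A \<subseteq> A' \<Longrightarrow> B \<subseteq> B' \<Longrightarrow> set_hadd R A B \<subseteq> set_hadd R A' B'"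
  unfolding set_hadd_def by blast

lemma mem_set_hadd:
  "x \<in> set_hadd R A B \<longleftrightarrow> (\<exists>a\<in>A. \<exists>b\<in>B. x \<in> hadd R a b)"
  unfolding set_hadd_def by blast

lemma hyperideal_subset_carrier: "hyperideal R I \<Longrightarrow> I \<subseteq> carrier R"
  unfolding hyperideal_def by blast

context semihyperring
begin

lemma set_hadd_closed:
  assumes "A \<subseteq> carrier R" "B \<subseteq> carrier R"
  shows "set_hadd R A B \<subseteq> carrier R"
  using assms hadd_closed unfolding set_hadd_def by blast

lemma set_hadd_commute:
  assumes "A \<subseteq> carrier R" "B \<subseteq> carrier R"
  shows "set_hadd R A B = set_hadd R B A"
proof -
  have "a \<boxplus> b = b \<boxplus> a" if "a \<in> A" "b \<in> B" for a b
    using that assms hadd_commute by blast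
  then show ?thesis unfolding set_hadd_def by blast
qed

lemma set_hadd_assoc:
  assumes "A \<subseteq> carrier R" "B \<subseteq> carrier R" "C \<subseteq> carrier R"
  shows "set_hadd R (set_hadd R A B) C = set_hadd R A (set_hadd R B C)"
proof -
  have *: "(\<Union>u\<in>a \<boxplus> b. u \<boxplus> c) = (\<Union>v\<in>b \<boxplus> c. a \<boxplus> v)" if "a \<in> A" "b \<in> B" "c \<in> C" for a b c
    using hadd_assoc[of a b c] that assms unfolding set_hadd_def by auto
  have "set_hadd R (set_hadd R A B) C = (\<Union>a\<in>A. \<Union>b\<in>B. \<Union>c\<in>C. \<Union>u\<in>a \<boxplus> b. u \<boxplus> c)"
    unfolding set_hadd_def by blast
  also have "\<dots> = (\<Union>a\<in>A. \<Union>b\<in>B. \<Union>c\<in>C. \<Union>v\<in>b \<boxplus> c. a \<boxplus> v)"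
    using * by simp
  also have "\<dots> = set_hadd R A (set_hadd R B C)"
    unfolding set_hadd_def by blast
  finally show ?thesis .
qed

lemma set_hadd_exchange:
  assumes "A \<subseteq> carrier R" "B \<subseteq> carrier R" "C \<subseteq> carrier R" "D \<subseteq> carrier R"
  shows "set_hadd R (set_hadd R A B) (set_hadd R C D) =
    set_hadd R (set_hadd R A C) (set_hadd R B D)"
proof -
  have "set_hadd R (set_hadd R A B) (set_hadd R C D) =
      set_hadd R A (set_hadd R (set_hadd R B C) D)"
    using assms by (simp add: set_hadd_assoc set_hadd_closed)
  also have "\<dots> = set_hadd R A (set_hadd R (set_hadd R C B) D)"
    using assms by (simp add: set_hadd_commute)
  also have "\<dots> = set_hadd R (set_hadd R A C) (set_hadd R B D)"
    using assms by (simp add: set_hadd_assoc set_hadd_closed)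
  finally show ?thesis .
qed

lemma hmult_hadd_left:
  assumes "r \<in> carrier R" "y \<in> carrier R" "z \<in> carrier R" "u \<in> y \<boxplus> z"
  shows "r \<boxdot> u \<in> (r \<boxdot> y) \<boxplus> (r \<boxdot> z)"
  using distrib_left[OF assms(1-3)] assms(4) by blast

lemma hmult_hadd_right:
  assumes "r \<in> carrier R" "y \<in> carrier R" "z \<in> carrier R" "u \<in> y \<boxplus> z"
  shows "u \<boxdot> r \<in> (y \<boxdot> r) \<boxplus> (z \<boxdot> r)"
  using distrib_right[OF assms(2,3,1)] assms(4) by blast

lemma hyperideal_hzero:
  assumes "hyperideal R I" shows "hzero R \<in> I"
proof -
  obtain x where "x \<in> I" "x \<in> carrier R"
    using assms unfolding hyperideal_def by blast
  then have "hzero R \<boxdot> x \<in> I"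
    using assms zero_closed unfolding hyperideal_def by blast
  then show ?thesis using zero_hmult[OF \<open>x \<in> carrier R\<close>] by simp
qed

lemma hyperideal_carrier: "hyperideal R (carrier R)"
  unfolding hyperideal_def using carrier_nonempty hadd_closed hmult_closed by blast

lemma hyperideal_Int:
  assumes "hyperideal R I" "hyperideal R J"
  shows "hyperideal R (I \<inter> J)"
  using assms hyperideal_hzero[OF assms(1)] hyperideal_hzero[OF assms(2)]
  unfolding hyperideal_def by blast

lemma hyperideal_set_hadd:
  assumes I: "hyperideal R I" and J: "hyperideal R J"
  shows "hyperideal R (set_hadd R I J)"
proof -
  note sub = hyperideal_subset_carrier[OF I] hyperideal_subset_carrier[OF J]
  have "set_hadd R (set_hadd R I J) (set_hadd R I J) = set_hadd R (set_hadd R I I) (set_hadd R J J)"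
    using sub by (intro set_hadd_exchange)
  also have "\<dots> \<subseteq> set_hadd R I J"
    using I J unfolding hyperideal_def by (intro set_hadd_mono) (simp_all add: set_hadd_def UN_least)
  finally have closed: "set_hadd R (set_hadd R I J) (set_hadd R I J) \<subseteq> set_hadd R I J" .
  have add: "x \<boxplus> y \<subseteq> set_hadd R I J"
    if "x \<in> set_hadd R I J" "y \<in> set_hadd R I J" for x y
    using closed that unfolding set_hadd_def[of R "set_hadd R I J"] by blast
  have mult: "r \<boxdot> x \<in> set_hadd R I J \<and> x \<boxdot> r \<in> set_hadd R I J"
    if r: "r \<in> carrier R" and x: "x \<in> set_hadd R I J" for r x
  proof -
    obtain a b where ab: "a \<in> I" "b \<in> J" "x \<in> a \<boxplus> b"
      using x by (auto simp: mem_set_hadd)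
    have "a \<in> carrier R" "b \<in> carrier R" using ab sub by auto
    then have "r \<boxdot> x \<in> (r \<boxdot> a) \<boxplus> (r \<boxdot> b)" "x \<boxdot> r \<in> (a \<boxdot> r) \<boxplus> (b \<boxdot> r)"
      using r ab hmult_hadd_left hmult_hadd_right by auto
    moreover have "r \<boxdot> a \<in> I" "a \<boxdot> r \<in> I" "r \<boxdot> b \<in> J" "b \<boxdot> r \<in> J"
      using I J r ab by (auto simp: hyperideal_def)
    ultimately show ?thesis by (auto simp: mem_set_hadd)
  qed
  have "hzero R \<in> set_hadd R I J"
    unfolding mem_set_hadd using hyperideal_hzero[OF I] hyperideal_hzero[OF J]
      zero_hadd[OF zero_closed] by blast
  then show ?thesis
    unfolding hyperideal_def using add mult set_hadd_closed[OF sub] by blast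
qed

lemma subset_set_hadd:
  assumes "A \<subseteq> carrier R" "B \<subseteq> carrier R"
  shows "hzero R \<in> B \<Longrightarrow> A \<subseteq> set_hadd R A B" "hzero R \<in> A \<Longrightarrow> B \<subseteq> set_hadd R A B"
proof -
  show "A \<subseteq> set_hadd R A B" if "hzero R \<in> B"
    using that assms hadd_zero unfolding set_hadd_def by fastforce
  show "B \<subseteq> set_hadd R A B" if "hzero R \<in> A"
    using that assms zero_hadd unfolding set_hadd_def by fastforce
qed

lemma hypersum_closed: "set xs \<subseteq> carrier R \<Longrightarrow> hypersum R xs \<subseteq> carrier R"
  by (induction xs) (simp_all add: zero_closed set_hadd_closed)

lemma hypersum_singleton: "x \<in> carrier R \<Longrightarrow> hypersum R [x] = {x}"
  by (simp add: set_hadd_def hadd_zero)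

lemma hypersum_append:
  assumes "set xs \<subseteq> carrier R" "set ys \<subseteq> carrier R"
  shows "hypersum R (xs @ ys) = set_hadd R (hypersum R xs) (hypersum R ys)"
  using assms(1)
proof (induction xs)
  case Nil
  have "set_hadd R {hzero R} (hypersum R ys) = hypersum R ys"
    using hypersum_closed[OF assms(2)] zero_hadd unfolding set_hadd_def by fastforce
  then show ?case by simp
next
  case (Cons x xs)
  then show ?case
    using assms(2) by (simp add: set_hadd_assoc hypersum_closed)
qed

lemma hypersum_subset:
  assumes "hzero R \<in> K" and "\<And>x y. x \<in> K \<Longrightarrow> y \<in> K \<Longrightarrow> x \<boxplus> y \<subseteq> K" and "set xs \<subseteq> K"
  shows "hypersum R xs \<subseteq> K"
  using assms(3)
proof (induction xs)
  case Nil
  then show ?case using assms(1) by simp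
next
  case (Cons x xs)
  then have "x \<in> K" "hypersum R xs \<subseteq> K" by auto
  then have "x \<boxplus> y \<subseteq> K" if "y \<in> hypersum R xs" for y using that assms(2)[of x y] by auto
  then show ?case by (simp add: set_hadd_def UN_least)
qed

lemma hypersum_hmult:
  assumes "r \<in> carrier R" "set xs \<subseteq> carrier R" "x \<in> hypersum R xs"
  shows "r \<boxdot> x \<in> hypersum R (map (\<lambda>u. r \<boxdot> u) xs)"
    and "x \<boxdot> r \<in> hypersum R (map (\<lambda>u. u \<boxdot> r) xs)"
proof -
  have "r \<boxdot> x \<in> hypersum R (map (\<lambda>u. r \<boxdot> u) xs) \<and> x \<boxdot> r \<in> hypersum R (map (\<lambda>u. u \<boxdot> r) xs)"
    using assms(2,3)
  proof (induction xs arbitrary: x)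
    case Nil
    then show ?case using assms(1) by (simp add: hmult_zero zero_hmult)
  next
    case (Cons a xs)
    then obtain y where y: "y \<in> hypersum R xs" "x \<in> a \<boxplus> y"
      by (auto simp: set_hadd_def)
    have "a \<in> carrier R" "y \<in> carrier R"
      using Cons.prems y hypersum_closed[of xs] by auto
    then have "r \<boxdot> x \<in> (r \<boxdot> a) \<boxplus> (r \<boxdot> y)" "x \<boxdot> r \<in> (a \<boxdot> r) \<boxplus> (y \<boxdot> r)"
      using assms(1) y hmult_hadd_left hmult_hadd_right by auto
    then show ?case using Cons.IH[of y] Cons.prems y by (auto simp: mem_set_hadd)
  qed
  then show "r \<boxdot> x \<in> hypersum R (map (\<lambda>u. r \<boxdot> u) xs)"
    and "x \<boxdot> r \<in> hypersum R (map (\<lambda>u. u \<boxdot> r) xs)" by auto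
qed

lemma mem_hyperideal_prod:
  assumes "a \<in> I" "b \<in> J" "I \<subseteq> carrier R" "J \<subseteq> carrier R"
  shows "a \<boxdot> b \<in> hyperideal_prod R I J"
proof -
  have "a \<boxdot> b \<in> carrier R" using assms hmult_closed by blast
  then have "a \<boxdot> b \<in> sum_of_products R [(a, b)]"
    unfolding sum_of_products_def using hypersum_singleton by simp
  then show ?thesis
    unfolding hyperideal_prod_def using assms(1,2) by (intro CollectI exI[of _ "[(a, b)]"]) simp
qed

text \<open>Products are generated by sums from elementary products, so inclusions need to be
  checked for the latter only.\<close>

lemma hyperideal_prod_subset:
  assumes "hyperideal R K" and "\<And>a b. a \<in> I \<Longrightarrow> b \<in> J \<Longrightarrow> a \<boxdot> b \<in> K"
  shows "hyperideal_prod R I J \<subseteq> K"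
proof
  fix x assume "x \<in> hyperideal_prod R I J"
  then obtain ps where ps: "set ps \<subseteq> I \<times> J" "x \<in> sum_of_products R ps"
    unfolding hyperideal_prod_def by blast
  have "hypersum R (map (\<lambda>(a, b). a \<boxdot> b) ps) \<subseteq> K"
  proof (rule hypersum_subset)
    show "hzero R \<in> K" using assms(1) by (rule hyperideal_hzero)
    show "x \<boxplus> y \<subseteq> K" if "x \<in> K" "y \<in> K" for x y
      using that assms(1) unfolding hyperideal_def by blast
    show "set (map (\<lambda>(a, b). a \<boxdot> b) ps) \<subseteq> K" using ps(1) assms(2) by auto
  qed
  then show "x \<in> K" using ps(2) unfolding sum_of_products_def by blast
qed

lemma hyperideal_prod_subset_Int:
  assumes "hyperideal R I" "hyperideal R J"
  shows "hyperideal_prod R I J \<subseteq> I \<inter> J"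
  using assms hyperideal_subset_carrier[OF assms(1)] hyperideal_subset_carrier[OF assms(2)]
  by (intro hyperideal_prod_subset hyperideal_Int) (auto simp: hyperideal_def)

lemma hyperideal_prod_mono:
  "I \<subseteq> I' \<Longrightarrow> J \<subseteq> J' \<Longrightarrow> hyperideal_prod R I J \<subseteq> hyperideal_prod R I' J'"
  unfolding hyperideal_prod_def by blast

lemma sum_of_products_append:
  assumes "set ps \<subseteq> carrier R \<times> carrier R" "set qs \<subseteq> carrier R \<times> carrier R"
  shows "sum_of_products R (ps @ qs) = set_hadd R (sum_of_products R ps) (sum_of_products R qs)"
  unfolding sum_of_products_def map_append
  using assms hmult_closed by (intro hypersum_append) auto

lemma hyperideal_hyperideal_prod:
  assumes I: "hyperideal R I" and J: "hyperideal R J"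
  shows "hyperideal R (hyperideal_prod R I J)"
proof -
  note sub = hyperideal_subset_carrier[OF I] hyperideal_subset_carrier[OF J]
  have add: "x \<boxplus> y \<subseteq> hyperideal_prod R I J"
    if xy: "x \<in> hyperideal_prod R I J" "y \<in> hyperideal_prod R I J" for x y
  proof -
    obtain ps qs where pq: "ps \<noteq> []" "set ps \<subseteq> I \<times> J" "x \<in> sum_of_products R ps"
      "set qs \<subseteq> I \<times> J" "y \<in> sum_of_products R qs"
      using xy unfolding hyperideal_prod_def by blast
    have "x \<boxplus> y \<subseteq> set_hadd R (sum_of_products R ps) (sum_of_products R qs)"
      using pq unfolding set_hadd_def by blast
    also have "\<dots> = sum_of_products R (ps @ qs)"
      using pq sub by (intro sum_of_products_append[symmetric]) auto
    finally show ?thesis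
      using pq unfolding hyperideal_prod_def by (intro subsetI CollectI exI[of _ "ps @ qs"]) auto
  qed
  have mult: "r \<boxdot> x \<in> hyperideal_prod R I J \<and> x \<boxdot> r \<in> hyperideal_prod R I J"
    if r: "r \<in> carrier R" and x: "x \<in> hyperideal_prod R I J" for r x
  proof -
    obtain ps where ps: "ps \<noteq> []" "set ps \<subseteq> I \<times> J" "x \<in> sum_of_products R ps"
      using x unfolding hyperideal_prod_def by blast
    let ?xs = "map (\<lambda>(a, b). a \<boxdot> b) ps"
    have c: "a \<in> I \<and> b \<in> J \<and> a \<in> carrier R \<and> b \<in> carrier R" if "(a, b) \<in> set ps" for a b
      using that ps(2) sub by blast
    then have xs: "set ?xs \<subseteq> carrier R" "x \<in> hypersum R ?xs"
      using ps(3) hmult_closed unfolding sum_of_products_def by auto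
    (* The scalar is absorbed by the first factors from the left, by the second ones from the right. *)
    have "map (\<lambda>u. r \<boxdot> u) ?xs = map (\<lambda>(a, b). a \<boxdot> b) (map (\<lambda>(a, b). (r \<boxdot> a, b)) ps)"
      using c r by (auto simp: hmult_assoc)
    then have "r \<boxdot> x \<in> sum_of_products R (map (\<lambda>(a, b). (r \<boxdot> a, b)) ps)"
      using hypersum_hmult(1)[OF r xs] unfolding sum_of_products_def by (simp only:)
    moreover have "set (map (\<lambda>(a, b). (r \<boxdot> a, b)) ps) \<subseteq> I \<times> J"
      using c I r unfolding hyperideal_def by auto
    moreover have "map (\<lambda>u. u \<boxdot> r) ?xs = map (\<lambda>(a, b). a \<boxdot> b) (map (\<lambda>(a, b). (a, b \<boxdot> r)) ps)"
      using c r by (auto simp: hmult_assoc)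
    then have "x \<boxdot> r \<in> sum_of_products R (map (\<lambda>(a, b). (a, b \<boxdot> r)) ps)"
      using hypersum_hmult(2)[OF r xs] unfolding sum_of_products_def by (simp only:)
    moreover have "set (map (\<lambda>(a, b). (a, b \<boxdot> r)) ps) \<subseteq> I \<times> J"
      using c J r unfolding hyperideal_def by auto
    ultimately show ?thesis
      using ps(1) unfolding hyperideal_prod_def by (metis (mono_tags, lifting) CollectI Nil_is_map_conv)
  qed
  have "hzero R \<boxdot> hzero R \<in> hyperideal_prod R I J"
    using mem_hyperideal_prod[OF hyperideal_hzero[OF I] hyperideal_hzero[OF J] sub] .
  moreover have "hyperideal_prod R I J \<subseteq> carrier R"
    using hyperideal_prod_subset_Int[OF I J] sub by blast
  ultimately show ?thesis
    unfolding hyperideal_def using add mult by blast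
qed

section \<open>Fully idempotent semihyperrings\<close>

lemma fully_idempotentI:
  assumes "\<And>I. hyperideal R I \<Longrightarrow> I \<subseteq> hyperideal_prod R I I"
  shows "fully_idempotent R"
  unfolding fully_idempotent_def using assms hyperideal_prod_subset_Int by fastforce

lemma fully_idempotent_Int_eq_prod:
  assumes "fully_idempotent R" "hyperideal R I" "hyperideal R J"
  shows "I \<inter> J = hyperideal_prod R I J"
proof
  have "I \<inter> J = hyperideal_prod R (I \<inter> J) (I \<inter> J)"
    using assms hyperideal_Int unfolding fully_idempotent_def by simp
  also have "\<dots> \<subseteq> hyperideal_prod R I J"
    by (intro hyperideal_prod_mono) auto
  finally show "I \<inter> J \<subseteq> hyperideal_prod R I J" .
qed (rule hyperideal_prod_subset_Int[OF assms(2,3)])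

lemma fully_idempotent_Int_set_hadd:
  assumes idem: "fully_idempotent R"
    and I: "hyperideal R I" and J: "hyperideal R J" and K: "hyperideal R K"
  shows "I \<inter> set_hadd R J K \<subseteq> set_hadd R (I \<inter> J) (I \<inter> K)"
proof -
  note sub = hyperideal_subset_carrier[OF I] hyperideal_subset_carrier[OF J]
    hyperideal_subset_carrier[OF K]
  have "a \<boxdot> u \<in> set_hadd R (I \<inter> J) (I \<inter> K)" if a: "a \<in> I" and u: "u \<in> set_hadd R J K" for a u
  proof -
    obtain b c where bc: "b \<in> J" "c \<in> K" "u \<in> b \<boxplus> c"
      using u by (auto simp: mem_set_hadd)
    have abc: "a \<in> carrier R" "b \<in> carrier R" "c \<in> carrier R" using a bc sub by auto
    then have "a \<boxdot> u \<in> (a \<boxdot> b) \<boxplus> (a \<boxdot> c)" using bc hmult_hadd_left by auto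
    moreover have "a \<boxdot> b \<in> I \<inter> J" "a \<boxdot> c \<in> I \<inter> K"
      using I J K a bc abc by (auto simp: hyperideal_def)
    ultimately show ?thesis by (auto simp: mem_set_hadd)
  qed
  then have "hyperideal_prod R I (set_hadd R J K) \<subseteq> set_hadd R (I \<inter> J) (I \<inter> K)"
    using I J K by (intro hyperideal_prod_subset hyperideal_set_hadd hyperideal_Int)
  then show ?thesis
    using fully_idempotent_Int_eq_prod[OF idem I hyperideal_set_hadd[OF J K]] by simp
qed

lemma hyperideal_Union_chain:
  assumes "C \<noteq> {}" and ideals: "\<And>I. I \<in> C \<Longrightarrow> hyperideal R I"
    and chain: "\<And>I J. I \<in> C \<Longrightarrow> J \<in> C \<Longrightarrow> I \<subseteq> J \<or> J \<subseteq> I"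
  shows "hyperideal R (\<Union>C)"
proof -
  have "x \<boxplus> y \<subseteq> \<Union>C" if xy: "x \<in> \<Union>C" "y \<in> \<Union>C" for x y
  proof -
    obtain K where "K \<in> C" "x \<in> K" "y \<in> K" using xy chain by blast
    then show ?thesis using ideals[of K] unfolding hyperideal_def by blast
  qed
  moreover have "r \<boxdot> x \<in> \<Union>C \<and> x \<boxdot> r \<in> \<Union>C" if rx: "r \<in> carrier R" "x \<in> \<Union>C" for r x
    using rx ideals unfolding hyperideal_def by blast
  moreover have "hzero R \<in> \<Union>C" using assms(1) ideals hyperideal_hzero by blast
  moreover have "\<Union>C \<subseteq> carrier R" using ideals hyperideal_subset_carrier by blast
  ultimately show ?thesis unfolding hyperideal_def by blast
qed

text \<open>A hyperideal that is maximal among those avoiding a given element is prime: if neither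
  factor of a product inside \<open>P\<close> lies in \<open>P\<close>, the element belongs to both sums of \<open>P\<close> with the
  factors, hence to their product, and that product is contained in \<open>P\<close>.\<close>

lemma maximal_avoiding_hyperprime:
  assumes idem: "fully_idempotent R" and P: "hyperideal R P" and a: "a \<notin> P"
    and maximal: "\<And>Q. hyperideal R Q \<Longrightarrow> P \<subseteq> Q \<Longrightarrow> a \<notin> Q \<Longrightarrow> Q = P"
  shows "hyperprime R P"
  unfolding hyperprime_def
proof (intro conjI allI impI P)
  fix I J assume "hyperideal R I \<and> hyperideal R J \<and> hyperideal_prod R I J \<subseteq> P"
  then have I: "hyperideal R I" and J: "hyperideal R J" and IJ: "hyperideal_prod R I J \<subseteq> P"
    by auto
  note sub = hyperideal_subset_carrier[OF I] hyperideal_subset_carrier[OF J]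
    hyperideal_subset_carrier[OF P]
  have mem: "a \<in> set_hadd R P Q" if Q: "hyperideal R Q" "\<not> Q \<subseteq> P" for Q
  proof (rule ccontr)
    assume "a \<notin> set_hadd R P Q"
    then have "set_hadd R P Q = P"
      using Q P subset_set_hadd(1)[OF sub(3) hyperideal_subset_carrier[OF Q(1)]]
      by (intro maximal hyperideal_set_hadd) (auto simp: hyperideal_hzero)
    then show False
      using Q(2) subset_set_hadd(2)[OF sub(3) hyperideal_subset_carrier[OF Q(1)]]
        hyperideal_hzero[OF P] by blast
  qed
  have "u \<boxdot> v \<in> P" if uv: "u \<in> set_hadd R P I" "v \<in> set_hadd R P J" for u v
  proof -
    obtain p i where pi: "p \<in> P" "i \<in> I" "u \<in> p \<boxplus> i" using uv by (auto simp: mem_set_hadd)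
    obtain q j where qj: "q \<in> P" "j \<in> J" "v \<in> q \<boxplus> j" using uv by (auto simp: mem_set_hadd)
    have c: "p \<in> carrier R" "i \<in> carrier R" "q \<in> carrier R" "j \<in> carrier R" "v \<in> carrier R"
      using pi qj sub set_hadd_closed[OF sub(3) sub(2)] uv by auto
    have "i \<boxdot> j \<in> P" using mem_hyperideal_prod[OF pi(2) qj(2) sub(1,2)] IJ by blast
    then have "(i \<boxdot> q) \<boxplus> (i \<boxdot> j) \<subseteq> P" using P qj c unfolding hyperideal_def by blast
    then have "i \<boxdot> v \<in> P" using hmult_hadd_left[of i q j v] c qj by blast
    then have "(p \<boxdot> v) \<boxplus> (i \<boxdot> v) \<subseteq> P" using P pi c unfolding hyperideal_def by blast
    then show ?thesis using hmult_hadd_right[of v p i u] c pi by blast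
  qed
  then have "hyperideal_prod R (set_hadd R P I) (set_hadd R P J) \<subseteq> P"
    using P by (intro hyperideal_prod_subset)
  then have "set_hadd R P I \<inter> set_hadd R P J \<subseteq> P"
    using fully_idempotent_Int_eq_prod[OF idem] hyperideal_set_hadd P I J by simp
  then show "I \<subseteq> P \<or> J \<subseteq> P" using mem I J a by blast
qed

lemma exists_hyperprime_avoiding:
  assumes idem: "fully_idempotent R" and I: "hyperideal R I" and a: "a \<notin> I"
  obtains P where "hyperprime R P" "I \<subseteq> P" "a \<notin> P"
proof -
  define F where "F = {Q. hyperideal R Q \<and> I \<subseteq> Q \<and> a \<notin> Q}"
  have "\<exists>P\<in>F. \<forall>Q\<in>F. P \<subseteq> Q \<longrightarrow> Q = P"
  proof (rule subset_Zorn_nonempty)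
    show "F \<noteq> {}" using I a unfolding F_def by blast
    fix C assume C: "C \<noteq> {}" "subset.chain F C"
    then have CF: "C \<subseteq> F" and chain: "\<And>Q Q'. Q \<in> C \<Longrightarrow> Q' \<in> C \<Longrightarrow> Q \<subseteq> Q' \<or> Q' \<subseteq> Q"
      unfolding subset_chain_def by auto
    have "hyperideal R (\<Union>C)"
      using C(1) CF chain unfolding F_def by (intro hyperideal_Union_chain) auto
    then show "\<Union>C \<in> F" using C(1) CF unfolding F_def by blast
  qed
  then obtain P where "P \<in> F" and max: "\<And>Q. Q \<in> F \<Longrightarrow> P \<subseteq> Q \<Longrightarrow> Q = P" by blast
  then have P: "hyperideal R P" "I \<subseteq> P" "a \<notin> P" unfolding F_def by auto
  moreover have "hyperprime R P"
    using P by (intro maximal_avoiding_hyperprime[OF idem, of P a] max) (auto simp: F_def)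
  ultimately show thesis using that by blast
qed

section \<open>Regular semihyperrings\<close>

lemma hregular_imp_fully_idempotent:
  assumes "hregular R" shows "fully_idempotent R"
proof (intro fully_idempotentI subsetI)
  fix I x assume I: "hyperideal R I" and x: "x \<in> I"
  then have xc: "x \<in> carrier R" using hyperideal_subset_carrier by blast
  then obtain a where a: "a \<in> carrier R" "x = x \<boxdot> a \<boxdot> x"
    using assms unfolding hregular_def by blast
  have "x \<boxdot> a \<in> I" using I x a(1) unfolding hyperideal_def by blast
  then have "x \<boxdot> a \<boxdot> x \<in> hyperideal_prod R I I"
    using mem_hyperideal_prod x hyperideal_subset_carrier[OF I] by blast
  then show "x \<in> hyperideal_prod R I I" using a(2) by simp
qed

lemma hyperideal_multiples:
  assumes comm: "hcommutative R" and x: "x \<in> carrier R"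
  shows "hyperideal R ((\<lambda>u. u \<boxdot> x) ` carrier R)" (is "hyperideal R ?M")
proof -
  have "u \<boxplus> v \<subseteq> ?M" if uv: "u \<in> ?M" "v \<in> ?M" for u v
  proof -
    obtain c d where cd: "c \<in> carrier R" "d \<in> carrier R" "u = c \<boxdot> x" "v = d \<boxdot> x"
      using uv by blast
    then have "u \<boxplus> v = (\<lambda>w. w \<boxdot> x) ` (c \<boxplus> d)" using distrib_right x by simp
    then show ?thesis using hadd_closed cd by blast
  qed
  moreover have "r \<boxdot> u \<in> ?M \<and> u \<boxdot> r \<in> ?M" if ru: "r \<in> carrier R" "u \<in> ?M" for r u
  proof -
    obtain c where c: "c \<in> carrier R" "u = c \<boxdot> x" using ru by blast
    then have "r \<boxdot> u = (r \<boxdot> c) \<boxdot> x" using ru x hmult_assoc by simp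
    moreover have "u \<boxdot> r = r \<boxdot> u"
      using comm ru c x hmult_closed unfolding hcommutative_def by blast
    ultimately show ?thesis using ru c hmult_closed by auto
  qed
  moreover have "?M \<subseteq> carrier R" "?M \<noteq> {}" using x hmult_closed carrier_nonempty by auto
  ultimately show ?thesis unfolding hyperideal_def by blast
qed

text \<open>Idempotency of \<open>J = {y. Ry \<subseteq> Rx}\<close> is used twice. As \<open>JJ \<subseteq> Rx\<close>, it first gives
  \<open>J \<subseteq> Rx\<close>. Therefore products of elements of \<open>J\<close> have the form \<open>(cx)(dx) = (cd)(xx)\<close>, and
  \<open>x \<in> J = JJ\<close> then gives \<open>x = w(xx) = xwx\<close>.\<close>

lemma fully_idempotent_imp_hregular:
  assumes comm: "hcommutative R" and idem: "fully_idempotent R"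
  shows "hregular R"
  unfolding hregular_def
proof
  fix x assume x: "x \<in> carrier R"
  have xx: "x \<boxdot> x \<in> carrier R" using x hmult_closed by blast
  define M where "M = (\<lambda>u. u \<boxdot> x) ` carrier R"
  define N where "N = (\<lambda>u. u \<boxdot> (x \<boxdot> x)) ` carrier R"
  define J where "J = {y \<in> carrier R. \<forall>r\<in>carrier R. r \<boxdot> y \<in> M}"
  have M: "hyperideal R M" unfolding M_def by (rule hyperideal_multiples[OF comm x])
  have N: "hyperideal R N" unfolding N_def by (rule hyperideal_multiples[OF comm xx])
  have J: "hyperideal R J"
  proof -
    have "y \<boxplus> z \<subseteq> J" if yz: "y \<in> J" "z \<in> J" for y z
    proof
      fix u assume u: "u \<in> y \<boxplus> z"
      have c: "y \<in> carrier R" "z \<in> carrier R" using yz unfolding J_def by auto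
      have "r \<boxdot> u \<in> M" if r: "r \<in> carrier R" for r
      proof -
        have "(r \<boxdot> y) \<boxplus> (r \<boxdot> z) \<subseteq> M" using yz r M unfolding J_def hyperideal_def by blast
        then show ?thesis using hmult_hadd_left[OF r c u] by blast
      qed
      then show "u \<in> J" using hadd_closed[OF c] u unfolding J_def by blast
    qed
    moreover have "s \<boxdot> y \<in> J \<and> y \<boxdot> s \<in> J" if sy: "s \<in> carrier R" "y \<in> J" for s y
    proof -
      have y: "y \<in> carrier R" using sy unfolding J_def by blast
      have "r \<boxdot> (s \<boxdot> y) \<in> M" if "r \<in> carrier R" for r
        using that sy y hmult_assoc[of r s y, symmetric] hmult_closed[of r s]
        unfolding J_def by simp
      then have "s \<boxdot> y \<in> J" using sy y hmult_closed unfolding J_def by blast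
      moreover have "y \<boxdot> s = s \<boxdot> y" using comm sy y unfolding hcommutative_def by blast
      ultimately show ?thesis by simp
    qed
    moreover have "x \<in> J" unfolding J_def M_def using x by blast
    moreover have "J \<subseteq> carrier R" unfolding J_def by blast
    ultimately show ?thesis unfolding hyperideal_def by blast
  qed
  have JJ: "hyperideal_prod R J J = J" using idem J unfolding fully_idempotent_def by blast
  have "hyperideal_prod R J J \<subseteq> M"
    by (rule hyperideal_prod_subset[OF M]) (auto simp: J_def)
  then have JM: "J \<subseteq> M" using JJ by simp
  have "hyperideal_prod R J J \<subseteq> N"
  proof (rule hyperideal_prod_subset[OF N])
    fix a b assume "a \<in> J" "b \<in> J"
    then obtain c d where cd: "c \<in> carrier R" "d \<in> carrier R" "a = c \<boxdot> x" "b = d \<boxdot> x"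
      using JM unfolding M_def by blast
    have "a \<boxdot> b = c \<boxdot> ((x \<boxdot> d) \<boxdot> x)" using cd x by (simp add: hmult_assoc hmult_closed)
    also have "x \<boxdot> d = d \<boxdot> x" using comm cd x unfolding hcommutative_def by blast
    also have "c \<boxdot> ((d \<boxdot> x) \<boxdot> x) = (c \<boxdot> d) \<boxdot> (x \<boxdot> x)"
      using cd x by (simp add: hmult_assoc hmult_closed)
    finally show "a \<boxdot> b \<in> N" unfolding N_def using cd hmult_closed by blast
  qed
  moreover have "x \<in> J" unfolding J_def M_def using x by blast
  ultimately have "x \<in> N" using JJ by blast
  then obtain w where w: "w \<in> carrier R" "x = w \<boxdot> (x \<boxdot> x)" unfolding N_def by blast
  then have "x = (w \<boxdot> x) \<boxdot> x" using hmult_assoc[OF w(1) x x] by simp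
  also have "w \<boxdot> x = x \<boxdot> w" using comm w x unfolding hcommutative_def by blast
  finally show "\<exists>a\<in>carrier R. x = x \<boxdot> a \<boxdot> x" using w(1) by blast
qed

end

section \<open>Cuts of fuzzy subsets\<close>

definition cut :: "('a, 'b) hyperstructure_scheme \<Rightarrow> ('a \<Rightarrow> real) \<Rightarrow> real \<Rightarrow> 'a set" where
  "cut R m t = {x \<in> carrier R. t < m x}"

text \<open>With \<open>s = 0\<close> this is the characteristic function of \<open>P\<close>; other values of \<open>s\<close> give the
  fuzzy primes over a prime hyperideal \<open>P\<close>.\<close>

definition step_function :: "('a, 'b) hyperstructure_scheme \<Rightarrow> 'a set \<Rightarrow> real \<Rightarrow> 'a \<Rightarrow> real" where
  "step_function R P s = (\<lambda>x\<in>carrier R. if x \<in> P then 1 else s)"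

lemma fuzzy_subsetsD:
  "m \<in> fuzzy_subsets R \<Longrightarrow> x \<in> carrier R \<Longrightarrow> 0 \<le> m x \<and> m x \<le> 1"
  unfolding fuzzy_subsets_def by (auto simp: PiE_iff)

lemma fuzzy_hyperideal_fuzzy_subsets: "fuzzy_hyperideal R m \<Longrightarrow> m \<in> fuzzy_subsets R"
  unfolding fuzzy_hyperideal_def by blast

lemma cut_subset_carrier: "cut R m t \<subseteq> carrier R"
  unfolding cut_def by blast

lemma less_unit_Sup_iff:
  assumes "S \<subseteq> {0..1}" "0 \<le> t"
  shows "t < unit_Sup S \<longleftrightarrow> (\<exists>s\<in>S. t < s)"
proof (cases "S = {}")
  case True
  then show ?thesis using assms(2) by (simp add: unit_Sup_def)
next
  case False
  moreover have "bdd_above S" using assms(1) by (intro bdd_aboveI[of _ 1]) auto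
  ultimately show ?thesis by (simp add: unit_Sup_def less_cSup_iff)
qed

lemma unit_Sup_in_unit_interval:
  assumes "S \<subseteq> {0..1}" shows "unit_Sup S \<in> {0..1}"
proof (cases "S = {}")
  case False
  then obtain s where s: "s \<in> S" by blast
  have "bdd_above S" using assms by (intro bdd_aboveI[of _ 1]) auto
  then have "s \<le> Sup S" using s by (rule cSup_upper[rotated])
  moreover have "0 \<le> s" using s assms by auto
  moreover have "Sup S \<le> 1" using False assms by (intro cSup_least) auto
  ultimately show ?thesis using False by (simp add: unit_Sup_def)
qed (simp add: unit_Sup_def)

lemma fuzzy_le_iff_cuts:
  assumes "l \<in> fuzzy_subsets R" "m \<in> fuzzy_subsets R"
  shows "fuzzy_le R l m \<longleftrightarrow> (\<forall>t. 0 \<le> t \<and> t < 1 \<longrightarrow> cut R l t \<subseteq> cut R m t)"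
proof
  assume "fuzzy_le R l m"
  then show "\<forall>t. 0 \<le> t \<and> t < 1 \<longrightarrow> cut R l t \<subseteq> cut R m t"
    unfolding fuzzy_le_def cut_def by fastforce
next
  assume cuts: "\<forall>t. 0 \<le> t \<and> t < 1 \<longrightarrow> cut R l t \<subseteq> cut R m t"
  show "fuzzy_le R l m"
    unfolding fuzzy_le_def
  proof (intro ballI leI notI)
    fix x assume x: "x \<in> carrier R" and less: "m x < l x"
    have "0 \<le> m x" "m x < 1" using assms[THEN fuzzy_subsetsD, OF x] less by auto
    then have "cut R l (m x) \<subseteq> cut R m (m x)" using cuts by blast
    then show False using x less unfolding cut_def by auto
  qed
qed

lemma fuzzy_le_antisym:
  assumes "l \<in> fuzzy_subsets R" "m \<in> fuzzy_subsets R" "fuzzy_le R l m" "fuzzy_le R m l"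
  shows "l = m"
proof (rule PiE_ext)
  show "l \<in> carrier R \<rightarrow>\<^sub>E {0..1}" "m \<in> carrier R \<rightarrow>\<^sub>E {0..1}"
    using assms unfolding fuzzy_subsets_def by auto
  show "l x = m x" if "x \<in> carrier R" for x
    using assms that unfolding fuzzy_le_def by (intro order_antisym) auto
qed

lemma fuzzy_eq_iff_cuts:
  assumes "l \<in> fuzzy_subsets R" "m \<in> fuzzy_subsets R"
  shows "l = m \<longleftrightarrow> (\<forall>t. 0 \<le> t \<and> t < 1 \<longrightarrow> cut R l t = cut R m t)"
  using fuzzy_le_antisym[OF assms] fuzzy_le_iff_cuts[OF assms] fuzzy_le_iff_cuts[OF assms(2,1)]
  by (metis order_refl)

lemma fuzzy_sum_values_subset:
  assumes "l \<in> fuzzy_subsets R" "m \<in> fuzzy_subsets R"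
  shows "{min (l y) (m z) |y z. y \<in> carrier R \<and> z \<in> carrier R \<and> x \<in> hadd R y z} \<subseteq> {0..1}"
  using assms[THEN fuzzy_subsetsD] by (auto simp: min_le_iff_disj)

lemma fuzzy_prod_values_subset:
  assumes "l \<in> fuzzy_subsets R" "m \<in> fuzzy_subsets R"
  shows "{Min ((\<lambda>(y, z). min (l y) (m z)) ` set ps) |ps.
    ps \<noteq> [] \<and> set ps \<subseteq> carrier R \<times> carrier R \<and> x \<in> sum_of_products R ps} \<subseteq> {0..1}"
proof clarify
  fix ps :: "('a \<times> 'a) list" assume ps: "ps \<noteq> []" "set ps \<subseteq> carrier R \<times> carrier R"
  have "Min ((\<lambda>(y, z). min (l y) (m z)) ` set ps) \<in> (\<lambda>(y, z). min (l y) (m z)) ` set ps"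
    using ps(1) by (intro Min_in) auto
  also have "\<dots> \<subseteq> {0..1}"
    using ps(2) assms[THEN fuzzy_subsetsD] by (fastforce simp: min_le_iff_disj)
  finally show "Min ((\<lambda>(y, z). min (l y) (m z)) ` set ps) \<in> {0..1}" .
qed

lemma fuzzy_meet_fuzzy_subsets:
  "l \<in> fuzzy_subsets R \<Longrightarrow> m \<in> fuzzy_subsets R \<Longrightarrow> fuzzy_meet R l m \<in> fuzzy_subsets R"
  unfolding fuzzy_meet_def fuzzy_subsets_def by (auto simp: PiE_iff min_le_iff_disj)

lemma fuzzy_sum_fuzzy_subsets:
  assumes "l \<in> fuzzy_subsets R" "m \<in> fuzzy_subsets R"
  shows "fuzzy_sum R l m \<in> fuzzy_subsets R"
  unfolding fuzzy_sum_def fuzzy_subsets_def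
  by (subst restrict_PiE_iff) (intro ballI unit_Sup_in_unit_interval fuzzy_sum_values_subset assms)

lemma fuzzy_prod_fuzzy_subsets:
  assumes "l \<in> fuzzy_subsets R" "m \<in> fuzzy_subsets R"
  shows "fuzzy_prod R l m \<in> fuzzy_subsets R"
  unfolding fuzzy_prod_def fuzzy_subsets_def
  by (subst restrict_PiE_iff) (intro ballI unit_Sup_in_unit_interval fuzzy_prod_values_subset assms)

lemma step_function_fuzzy_subsets:
  "0 \<le> s \<Longrightarrow> s \<le> 1 \<Longrightarrow> step_function R P s \<in> fuzzy_subsets R"
  unfolding step_function_def fuzzy_subsets_def by auto

lemma cut_fuzzy_meet: "cut R (fuzzy_meet R l m) t = cut R l t \<inter> cut R m t"
  unfolding cut_def fuzzy_meet_def by auto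

lemma cut_step_function:
  assumes "P \<subseteq> carrier R" "t < 1"
  shows "cut R (step_function R P s) t = (if t < s then carrier R else P)"
  using assms unfolding cut_def step_function_def by auto

lemma (in semihyperring) cut_fuzzy_sum:
  assumes "l \<in> fuzzy_subsets R" "m \<in> fuzzy_subsets R" "0 \<le> t"
  shows "cut R (fuzzy_sum R l m) t = set_hadd R (cut R l t) (cut R m t)"
proof -
  have "x \<in> cut R (fuzzy_sum R l m) t \<longleftrightarrow> x \<in> set_hadd R (cut R l t) (cut R m t)"
    if x: "x \<in> carrier R" for x
    using x less_unit_Sup_iff[OF fuzzy_sum_values_subset[OF assms(1,2)] assms(3), of x]
    by (fastforce simp: cut_def fuzzy_sum_def mem_set_hadd)
  moreover have "set_hadd R (cut R l t) (cut R m t) \<subseteq> carrier R"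
    by (intro set_hadd_closed cut_subset_carrier)
  moreover have "cut R (fuzzy_sum R l m) t \<subseteq> carrier R" by (rule cut_subset_carrier)
  ultimately show ?thesis by blast
qed

lemma (in semihyperring) cut_fuzzy_prod:
  assumes "l \<in> fuzzy_subsets R" "m \<in> fuzzy_subsets R" "0 \<le> t"
  shows "cut R (fuzzy_prod R l m) t = hyperideal_prod R (cut R l t) (cut R m t)"
proof -
  have Min: "t < Min ((\<lambda>(y, z). min (l y) (m z)) ` set ps) \<and> set ps \<subseteq> carrier R \<times> carrier R
      \<longleftrightarrow> set ps \<subseteq> cut R l t \<times> cut R m t" if "ps \<noteq> []" for ps
    using that by (auto simp: cut_def)
  have "x \<in> cut R (fuzzy_prod R l m) t \<longleftrightarrow> x \<in> hyperideal_prod R (cut R l t) (cut R m t)"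
    if x: "x \<in> carrier R" for x
  proof -
    have "x \<in> cut R (fuzzy_prod R l m) t \<longleftrightarrow> (\<exists>ps. ps \<noteq> [] \<and> x \<in> sum_of_products R ps \<and>
        t < Min ((\<lambda>(y, z). min (l y) (m z)) ` set ps) \<and> set ps \<subseteq> carrier R \<times> carrier R)"
      using x less_unit_Sup_iff[OF fuzzy_prod_values_subset[OF assms(1,2)] assms(3), of x]
      by (simp add: cut_def fuzzy_prod_def) blast
    also have "\<dots> \<longleftrightarrow> x \<in> hyperideal_prod R (cut R l t) (cut R m t)"
      unfolding hyperideal_prod_def using Min by blast
    finally show ?thesis .
  qed
  moreover have "hyperideal_prod R (cut R l t) (cut R m t) \<subseteq> carrier R"
    by (rule hyperideal_prod_subset[OF hyperideal_carrier]) (simp add: cut_def hmult_closed)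
  moreover have "cut R (fuzzy_prod R l m) t \<subseteq> carrier R" by (rule cut_subset_carrier)
  ultimately show ?thesis by blast
qed

section \<open>Fuzzy hyperideals and their lattice\<close>

context semihyperring
begin

lemma fuzzy_hyperideal_altdef:
  "fuzzy_hyperideal R m \<longleftrightarrow> m \<in> fuzzy_subsets R \<and> m (hzero R) = 1 \<and>
     (\<forall>x\<in>carrier R. \<forall>y\<in>carrier R. (\<forall>z\<in>x \<boxplus> y. min (m x) (m y) \<le> m z) \<and>
        m x \<le> m (x \<boxdot> y) \<and> m x \<le> m (y \<boxdot> x))"
proof -
  have "min (m x) (m y) \<le> (INF z\<in>x \<boxplus> y. m z) \<longleftrightarrow> (\<forall>z\<in>x \<boxplus> y. min (m x) (m y) \<le> m z)"
    if m: "m \<in> fuzzy_subsets R" and xy: "x \<in> carrier R" "y \<in> carrier R" for x y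
  proof (rule le_cINF_iff)
    show "x \<boxplus> y \<noteq> {}" using hadd_nonempty xy by blast
    show "bdd_below (m ` (x \<boxplus> y))"
      using fuzzy_subsetsD[OF m] hadd_closed[OF xy] by (intro bdd_belowI[of _ 0]) auto
  qed
  then show ?thesis unfolding fuzzy_hyperideal_def by (simp cong: conj_cong ball_cong)
qed

text \<open>For the backward direction, a failing inequality is refuted by the cut at its smaller
  side, which is a value below 1. The value at zero is 1 because zero lies in every cut.\<close>

lemma fuzzy_hyperideal_iff_cuts:
  "fuzzy_hyperideal R m \<longleftrightarrow>
     m \<in> fuzzy_subsets R \<and> (\<forall>t. 0 \<le> t \<and> t < 1 \<longrightarrow> hyperideal R (cut R m t))"
proof
  assume fuzzy: "fuzzy_hyperideal R m"
  have "hyperideal R (cut R m t)" if t: "t < 1" for t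
  proof -
    have "x \<boxplus> y \<subseteq> cut R m t" if xy: "x \<in> cut R m t" "y \<in> cut R m t" for x y
    proof
      fix z assume z: "z \<in> x \<boxplus> y"
      have c: "x \<in> carrier R" "y \<in> carrier R" using xy unfolding cut_def by auto
      then have "min (m x) (m y) \<le> m z" using fuzzy z unfolding fuzzy_hyperideal_altdef by blast
      then show "z \<in> cut R m t" using xy hadd_closed[OF c] z unfolding cut_def by auto
    qed
    moreover have "r \<boxdot> x \<in> cut R m t \<and> x \<boxdot> r \<in> cut R m t"
      if rx: "r \<in> carrier R" "x \<in> cut R m t" for r x
    proof -
      have "x \<in> carrier R" "t < m x" using rx(2) unfolding cut_def by auto
      moreover have "m x \<le> m (r \<boxdot> x)" "m x \<le> m (x \<boxdot> r)"
        using fuzzy rx(1) \<open>x \<in> carrier R\<close> unfolding fuzzy_hyperideal_altdef by auto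
      ultimately show ?thesis using rx(1) hmult_closed unfolding cut_def by simp
    qed
    moreover have "hzero R \<in> cut R m t"
      using fuzzy t zero_closed unfolding fuzzy_hyperideal_altdef cut_def by simp
    ultimately show ?thesis
      unfolding hyperideal_def using cut_subset_carrier[of R m t] by blast
  qed
  then show "m \<in> fuzzy_subsets R \<and> (\<forall>t. 0 \<le> t \<and> t < 1 \<longrightarrow> hyperideal R (cut R m t))"
    using fuzzy fuzzy_hyperideal_fuzzy_subsets by blast
next
  assume R: "m \<in> fuzzy_subsets R \<and> (\<forall>t. 0 \<le> t \<and> t < 1 \<longrightarrow> hyperideal R (cut R m t))"
  note bounds = fuzzy_subsetsD[OF conjunct1[OF R]]
  have ideal: "hyperideal R (cut R m (m z))" if "z \<in> carrier R" "m z < 1" for z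
    using R that bounds by blast
  have below: "m z < 1" if "z \<in> carrier R" "x \<in> carrier R" "m z < m x" for z x
    using that bounds[of x] by linarith
  have "m (hzero R) = 1"
  proof (rule ccontr)
    assume "m (hzero R) \<noteq> 1"
    then have "m (hzero R) < 1" using bounds[OF zero_closed] by linarith
    then have "hzero R \<in> cut R m (m (hzero R))" using ideal zero_closed hyperideal_hzero by blast
    then show False unfolding cut_def by simp
  qed
  moreover have "min (m x) (m y) \<le> m z"
    if xyz: "x \<in> carrier R" "y \<in> carrier R" "z \<in> x \<boxplus> y" for x y z
  proof (rule ccontr)
    assume less: "\<not> min (m x) (m y) \<le> m z"
    have z: "z \<in> carrier R" using hadd_closed xyz by blast
    have "x \<in> cut R m (m z)" "y \<in> cut R m (m z)" using less xyz unfolding cut_def by auto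
    moreover have "hyperideal R (cut R m (m z))"
      using less xyz z below[of z x] by (intro ideal) auto
    ultimately have "z \<in> cut R m (m z)" using xyz unfolding hyperideal_def by blast
    then show False unfolding cut_def by simp
  qed
  moreover have "m x \<le> m z"
    if xy: "x \<in> carrier R" "y \<in> carrier R" "z = x \<boxdot> y \<or> z = y \<boxdot> x" for x y z
  proof (rule ccontr)
    assume less: "\<not> m x \<le> m z"
    have z: "z \<in> carrier R" using hmult_closed xy by blast
    have "x \<in> cut R m (m z)" using less xy unfolding cut_def by auto
    moreover have "hyperideal R (cut R m (m z))"
      using less xy z below[of z x] by (intro ideal) auto
    ultimately have "z \<in> cut R m (m z)" using xy unfolding hyperideal_def by blast
    then show False unfolding cut_def by simp
  qed
  ultimately show "fuzzy_hyperideal R m"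
    unfolding fuzzy_hyperideal_altdef using R by blast
qed

lemma hyperideal_cut:
  "fuzzy_hyperideal R m \<Longrightarrow> 0 \<le> t \<Longrightarrow> t < 1 \<Longrightarrow> hyperideal R (cut R m t)"
  unfolding fuzzy_hyperideal_iff_cuts by blast

lemma fuzzy_hyperideal_step_function:
  assumes "hyperideal R P" "0 \<le> s" "s \<le> 1"
  shows "fuzzy_hyperideal R (step_function R P s)"
  unfolding fuzzy_hyperideal_iff_cuts
  using assms hyperideal_carrier
  by (auto simp: step_function_fuzzy_subsets cut_step_function[OF hyperideal_subset_carrier])

lemma fuzzy_hyperideal_fuzzy_meet:
  assumes "fuzzy_hyperideal R l" "fuzzy_hyperideal R m"
  shows "fuzzy_hyperideal R (fuzzy_meet R l m)"
  unfolding fuzzy_hyperideal_iff_cuts[of "fuzzy_meet R l m"] cut_fuzzy_meet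
  using assms by (simp add: fuzzy_meet_fuzzy_subsets fuzzy_hyperideal_fuzzy_subsets
      hyperideal_Int hyperideal_cut)

lemma fuzzy_hyperideal_fuzzy_sum:
  assumes l: "fuzzy_hyperideal R l" and m: "fuzzy_hyperideal R m"
  shows "fuzzy_hyperideal R (fuzzy_sum R l m)"
proof -
  note sub = l[THEN fuzzy_hyperideal_fuzzy_subsets] m[THEN fuzzy_hyperideal_fuzzy_subsets]
  have "hyperideal R (cut R (fuzzy_sum R l m) t)" if "0 \<le> t" "t < 1" for t
    using that l m by (simp add: cut_fuzzy_sum[OF sub] hyperideal_set_hadd hyperideal_cut)
  then show ?thesis
    unfolding fuzzy_hyperideal_iff_cuts using fuzzy_sum_fuzzy_subsets[OF sub] by blast
qed

lemma fuzzy_le_fuzzy_sum: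
  assumes l: "fuzzy_hyperideal R l" and m: "fuzzy_hyperideal R m"
  shows "fuzzy_le R l (fuzzy_sum R l m)" "fuzzy_le R m (fuzzy_sum R l m)"
proof -
  note sub = l[THEN fuzzy_hyperideal_fuzzy_subsets] m[THEN fuzzy_hyperideal_fuzzy_subsets]
  have "cut R l t \<subseteq> cut R (fuzzy_sum R l m) t \<and> cut R m t \<subseteq> cut R (fuzzy_sum R l m) t"
    if t: "0 \<le> t" "t < 1" for t
    using subset_set_hadd[OF cut_subset_carrier cut_subset_carrier]
      hyperideal_hzero[OF hyperideal_cut[OF l t]] hyperideal_hzero[OF hyperideal_cut[OF m t]]
    by (simp add: cut_fuzzy_sum[OF sub t(1)])
  then show "fuzzy_le R l (fuzzy_sum R l m)" "fuzzy_le R m (fuzzy_sum R l m)"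
    using fuzzy_le_iff_cuts[OF sub(1) fuzzy_sum_fuzzy_subsets[OF sub]]
      fuzzy_le_iff_cuts[OF sub(2) fuzzy_sum_fuzzy_subsets[OF sub]] by auto
qed

lemma fuzzy_sum_least:
  assumes l: "l \<in> fuzzy_subsets R" and m: "m \<in> fuzzy_subsets R" and n: "fuzzy_hyperideal R n"
    and le: "fuzzy_le R l n" "fuzzy_le R m n"
  shows "fuzzy_le R (fuzzy_sum R l m) n"
proof -
  note n' = n[THEN fuzzy_hyperideal_fuzzy_subsets]
  have "cut R (fuzzy_sum R l m) t \<subseteq> cut R n t" if t: "0 \<le> t" "t < 1" for t
  proof -
    have "cut R l t \<subseteq> cut R n t" "cut R m t \<subseteq> cut R n t"
      using le t fuzzy_le_iff_cuts[OF l n'] fuzzy_le_iff_cuts[OF m n'] by auto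
    then have "set_hadd R (cut R l t) (cut R m t) \<subseteq> set_hadd R (cut R n t) (cut R n t)"
      by (rule set_hadd_mono)
    also have "\<dots> \<subseteq> cut R n t"
      using hyperideal_cut[OF n t] unfolding hyperideal_def set_hadd_def by blast
    finally show ?thesis by (simp add: cut_fuzzy_sum[OF l m t(1)])
  qed
  then show ?thesis using fuzzy_le_iff_cuts[OF fuzzy_sum_fuzzy_subsets[OF l m] n'] by blast
qed

lemma least_fuzzy_sum:
  assumes "fuzzy_hyperideal R l" "fuzzy_hyperideal R m"
  shows "least (fuzzy_hyperideal_order R) (fuzzy_sum R l m) (Upper (fuzzy_hyperideal_order R) {l, m})"
proof (rule least_UpperI)
  fix n assume "n \<in> Upper (fuzzy_hyperideal_order R) {l, m}"
  then have "fuzzy_hyperideal R n" "fuzzy_le R l n" "fuzzy_le R m n"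
    using assms unfolding Upper_def fuzzy_hyperideal_order_def by auto
  then show "fuzzy_sum R l m \<sqsubseteq>\<^bsub>fuzzy_hyperideal_order R\<^esub> n"
    using assms unfolding fuzzy_hyperideal_order_def
    by (simp add: fuzzy_sum_least fuzzy_hyperideal_fuzzy_subsets)
qed (use assms in \<open>auto simp: fuzzy_hyperideal_order_def fuzzy_le_fuzzy_sum
      fuzzy_hyperideal_fuzzy_sum\<close>)

lemma greatest_fuzzy_meet:
  assumes "fuzzy_hyperideal R l" "fuzzy_hyperideal R m"
  shows "greatest (fuzzy_hyperideal_order R) (fuzzy_meet R l m)
    (Lower (fuzzy_hyperideal_order R) {l, m})"
proof (rule greatest_LowerI)
  fix n assume "n \<in> Lower (fuzzy_hyperideal_order R) {l, m}"
  then have "fuzzy_le R n l" "fuzzy_le R n m"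
    using assms unfolding Lower_def fuzzy_hyperideal_order_def by auto
  then show "n \<sqsubseteq>\<^bsub>fuzzy_hyperideal_order R\<^esub> fuzzy_meet R l m"
    unfolding fuzzy_hyperideal_order_def fuzzy_le_def fuzzy_meet_def by simp
next
  show "fuzzy_meet R l m \<sqsubseteq>\<^bsub>fuzzy_hyperideal_order R\<^esub> n" if "n \<in> {l, m}" for n
    using that unfolding fuzzy_hyperideal_order_def fuzzy_le_def fuzzy_meet_def by auto
qed (use assms in \<open>auto simp: fuzzy_hyperideal_order_def fuzzy_hyperideal_fuzzy_meet\<close>)

lemma lattice_fuzzy_hyperideal_order: "lattice (fuzzy_hyperideal_order R)"
proof -
  interpret partial_order "fuzzy_hyperideal_order R"
  proof
    fix l m
    assume "l \<sqsubseteq>\<^bsub>fuzzy_hyperideal_order R\<^esub> m" "m \<sqsubseteq>\<^bsub>fuzzy_hyperideal_order R\<^esub> l"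
      "l \<in> carrier (fuzzy_hyperideal_order R)" "m \<in> carrier (fuzzy_hyperideal_order R)"
    then have "l = m"
      using fuzzy_le_antisym[of l R m] fuzzy_hyperideal_fuzzy_subsets[of R l]
        fuzzy_hyperideal_fuzzy_subsets[of R m]
      unfolding fuzzy_hyperideal_order_def by simp
    then show "l .=\<^bsub>fuzzy_hyperideal_order R\<^esub> m"
      unfolding fuzzy_hyperideal_order_def by simp
  qed (auto simp: fuzzy_hyperideal_order_def fuzzy_le_def, meson order_trans)
  show ?thesis
  proof
    fix l m
    assume "l \<in> carrier (fuzzy_hyperideal_order R)" "m \<in> carrier (fuzzy_hyperideal_order R)"
    then have lm: "fuzzy_hyperideal R l" "fuzzy_hyperideal R m"
      unfolding fuzzy_hyperideal_order_def by auto
    show "\<exists>n. least (fuzzy_hyperideal_order R) n (Upper (fuzzy_hyperideal_order R) {l, m})"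
      using least_fuzzy_sum[OF lm] by blast
    show "\<exists>n. greatest (fuzzy_hyperideal_order R) n (Lower (fuzzy_hyperideal_order R) {l, m})"
      using greatest_fuzzy_meet[OF lm] by blast
  qed
qed

lemma join_eq_fuzzy_sum:
  assumes "fuzzy_hyperideal R l" "fuzzy_hyperideal R m"
  shows "join (fuzzy_hyperideal_order R) l m = fuzzy_sum R l m"
proof -
  interpret lattice "fuzzy_hyperideal_order R" by (rule lattice_fuzzy_hyperideal_order)
  show ?thesis
    unfolding join_def sup_def using least_fuzzy_sum[OF assms]
    by (intro some_equality least_unique)
qed

lemma meet_eq_fuzzy_meet:
  assumes "fuzzy_hyperideal R l" "fuzzy_hyperideal R m"
  shows "meet (fuzzy_hyperideal_order R) l m = fuzzy_meet R l m"
proof -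
  interpret lattice "fuzzy_hyperideal_order R" by (rule lattice_fuzzy_hyperideal_order)
  show ?thesis
    unfolding meet_def inf_def using greatest_fuzzy_meet[OF assms]
    by (intro some_equality greatest_unique)
qed

lemma fully_idempotent_fuzzy_meet_eq_prod:
  assumes idem: "fully_idempotent R" and l: "fuzzy_hyperideal R l" and m: "fuzzy_hyperideal R m"
  shows "fuzzy_meet R l m = fuzzy_prod R l m"
proof -
  note sub = l[THEN fuzzy_hyperideal_fuzzy_subsets] m[THEN fuzzy_hyperideal_fuzzy_subsets]
  have "cut R (fuzzy_meet R l m) t = cut R (fuzzy_prod R l m) t" if t: "0 \<le> t" "t < 1" for t
    unfolding cut_fuzzy_meet cut_fuzzy_prod[OF sub t(1)]
    using fully_idempotent_Int_eq_prod[OF idem] hyperideal_cut l m t by simp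
  then show ?thesis
    using fuzzy_eq_iff_cuts[OF fuzzy_meet_fuzzy_subsets[OF sub] fuzzy_prod_fuzzy_subsets[OF sub]]
    by blast
qed

lemma fully_idempotent_fuzzy_meet_sum_distrib:
  assumes idem: "fully_idempotent R"
    and l: "fuzzy_hyperideal R l" and m: "fuzzy_hyperideal R m" and n: "fuzzy_hyperideal R n"
  shows "fuzzy_meet R l (fuzzy_sum R m n) = fuzzy_sum R (fuzzy_meet R l m) (fuzzy_meet R l n)"
proof -
  note sub = l[THEN fuzzy_hyperideal_fuzzy_subsets] m[THEN fuzzy_hyperideal_fuzzy_subsets]
    n[THEN fuzzy_hyperideal_fuzzy_subsets]
  note meets = fuzzy_hyperideal_fuzzy_meet[OF l m] fuzzy_hyperideal_fuzzy_meet[OF l n]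
  have "cut R (fuzzy_meet R l (fuzzy_sum R m n)) t =
      cut R (fuzzy_sum R (fuzzy_meet R l m) (fuzzy_meet R l n)) t" if t: "0 \<le> t" "t < 1" for t
  proof -
    let ?L = "cut R l t" and ?M = "cut R m t" and ?N = "cut R n t"
    have ideals: "hyperideal R ?L" "hyperideal R ?M" "hyperideal R ?N"
      using l m n t hyperideal_cut by auto
    have "set_hadd R (?L \<inter> ?M) (?L \<inter> ?N) \<subseteq> ?L"
      using ideals(1) unfolding hyperideal_def set_hadd_def by blast
    moreover have "set_hadd R (?L \<inter> ?M) (?L \<inter> ?N) \<subseteq> set_hadd R ?M ?N"
      by (intro set_hadd_mono) auto
    ultimately have "?L \<inter> set_hadd R ?M ?N = set_hadd R (?L \<inter> ?M) (?L \<inter> ?N)"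
      using fully_idempotent_Int_set_hadd[OF idem ideals] by blast
    then show ?thesis
      using t(1) sub by (simp add: cut_fuzzy_meet cut_fuzzy_sum fuzzy_meet_fuzzy_subsets)
  qed
  moreover have "fuzzy_meet R l (fuzzy_sum R m n) \<in> fuzzy_subsets R"
    using sub by (simp add: fuzzy_meet_fuzzy_subsets fuzzy_sum_fuzzy_subsets)
  moreover have "fuzzy_sum R (fuzzy_meet R l m) (fuzzy_meet R l n) \<in> fuzzy_subsets R"
    using sub by (simp add: fuzzy_meet_fuzzy_subsets fuzzy_sum_fuzzy_subsets)
  ultimately show ?thesis by (simp add: fuzzy_eq_iff_cuts)
qed

lemma fully_idempotent_distributive_lattice:
  assumes "fully_idempotent R"
  shows "distributive_lattice (fuzzy_hyperideal_order R)"
proof -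
  interpret lattice "fuzzy_hyperideal_order R" by (rule lattice_fuzzy_hyperideal_order)
  show ?thesis
  proof
    fix l m n
    assume "l \<in> carrier (fuzzy_hyperideal_order R)" "m \<in> carrier (fuzzy_hyperideal_order R)"
      "n \<in> carrier (fuzzy_hyperideal_order R)"
    then have lmn: "fuzzy_hyperideal R l" "fuzzy_hyperideal R m" "fuzzy_hyperideal R n"
      unfolding fuzzy_hyperideal_order_def by auto
    then show "l \<sqinter>\<^bsub>fuzzy_hyperideal_order R\<^esub> (m \<squnion>\<^bsub>fuzzy_hyperideal_order R\<^esub> n) =
        (l \<sqinter>\<^bsub>fuzzy_hyperideal_order R\<^esub> m) \<squnion>\<^bsub>fuzzy_hyperideal_order R\<^esub>
        (l \<sqinter>\<^bsub>fuzzy_hyperideal_order R\<^esub> n)"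
      using fully_idempotent_fuzzy_meet_sum_distrib[OF assms lmn]
      by (simp add: join_eq_fuzzy_sum meet_eq_fuzzy_meet fuzzy_hyperideal_fuzzy_sum
          fuzzy_hyperideal_fuzzy_meet)
  qed
qed

lemma fuzzy_meet_eq_prod_imp_fully_idempotent:
  assumes "\<And>l. fuzzy_hyperideal R l \<Longrightarrow> fuzzy_meet R l l = fuzzy_prod R l l"
  shows "fully_idempotent R"
proof (rule fully_idempotentI)
  fix I assume I: "hyperideal R I"
  let ?c = "step_function R I 0"
  have c: "fuzzy_hyperideal R ?c" using fuzzy_hyperideal_step_function[OF I] by simp
  have I_cut: "cut R ?c 0 = I" using cut_step_function[OF hyperideal_subset_carrier[OF I]] by simp
  have "I = cut R (fuzzy_meet R ?c ?c) 0" by (simp add: cut_fuzzy_meet I_cut)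
  also have "\<dots> = hyperideal_prod R I I"
    using assms[OF c] c[THEN fuzzy_hyperideal_fuzzy_subsets] by (simp add: cut_fuzzy_prod I_cut)
  finally show "I \<subseteq> hyperideal_prod R I I" by simp
qed

section \<open>Fuzzy prime hyperideals\<close>

text \<open>Primality is decided by the cuts at the single level \<open>s\<close>. The cut of the step function at
  \<open>s\<close> is \<open>P\<close>, so it contains the product of the cuts of \<open>l\<close> and \<open>m\<close>, and hence one of these
  cuts. A fuzzy subset whose cut at \<open>s\<close> lies in \<open>P\<close> has values at most \<open>s\<close> off \<open>P\<close>, so it
  is below the step function.\<close>

lemma fuzzy_prime_step_function:
  assumes P: "hyperprime R P" and s: "0 \<le> s" "s < 1"
  shows "fuzzy_prime R (step_function R P s)"
  unfolding fuzzy_prime_def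
proof (intro conjI allI impI)
  have ideal: "hyperideal R P" using P unfolding hyperprime_def by blast
  then show e: "fuzzy_hyperideal R (step_function R P s)"
    using fuzzy_hyperideal_step_function s by simp
  have cut_e: "cut R (step_function R P s) s = P"
    using cut_step_function[OF hyperideal_subset_carrier[OF ideal] s(2)] by simp
  fix l m
  assume "fuzzy_hyperideal R l \<and> fuzzy_hyperideal R m \<and>
    fuzzy_le R (fuzzy_prod R l m) (step_function R P s)"
  then have l: "fuzzy_hyperideal R l" and m: "fuzzy_hyperideal R m"
    and le: "fuzzy_le R (fuzzy_prod R l m) (step_function R P s)" by auto
  note sub = l[THEN fuzzy_hyperideal_fuzzy_subsets] m[THEN fuzzy_hyperideal_fuzzy_subsets]
  have "cut R (fuzzy_prod R l m) s \<subseteq> P"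
    using le s cut_e fuzzy_le_iff_cuts[OF fuzzy_prod_fuzzy_subsets[OF sub]
        fuzzy_hyperideal_fuzzy_subsets[OF e]] by blast
  then have "cut R l s \<subseteq> P \<or> cut R m s \<subseteq> P"
    using P hyperideal_cut l m s unfolding hyperprime_def by (simp add: cut_fuzzy_prod[OF sub])
  moreover have "fuzzy_le R n (step_function R P s)"
    if n: "n \<in> fuzzy_subsets R" "cut R n s \<subseteq> P" for n
    using n(2) fuzzy_subsetsD[OF n(1)] unfolding fuzzy_le_def step_function_def cut_def
    by (auto simp: not_less)
  ultimately show "fuzzy_le R l (step_function R P s) \<or> fuzzy_le R m (step_function R P s)"
    using sub by blast
qed

text \<open>The whole semihyperring is a prime hyperideal in the sense used here, so the constant
  function 1 is a fuzzy prime above everything. The infima over the fuzzy primes above a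
  function are therefore taken over nonempty sets.\<close>

lemma exists_fuzzy_prime_above:
  assumes "m \<in> fuzzy_subsets R"
  shows "{e. fuzzy_prime R e \<and> fuzzy_le R m e} \<noteq> {}"
proof -
  have "hyperprime R (carrier R)"
    unfolding hyperprime_def using hyperideal_carrier hyperideal_subset_carrier by blast
  then have "fuzzy_prime R (step_function R (carrier R) 0)"
    by (rule fuzzy_prime_step_function) auto
  moreover have "fuzzy_le R m (step_function R (carrier R) 0)"
    using fuzzy_subsetsD[OF assms] unfolding fuzzy_le_def step_function_def by simp
  ultimately show ?thesis by blast
qed

text \<open>The infimum is attained at each point \<open>a\<close>: if \<open>m a < 1\<close>, by the step function of level
  \<open>m a\<close> over a prime hyperideal that contains the cut of \<open>m\<close> at \<open>m a\<close> and avoids \<open>a\<close>; if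
  \<open>m a = 1\<close>, by every fuzzy prime above \<open>m\<close>.\<close>

lemma fully_idempotent_eq_Inter_fuzzy_primes:
  assumes idem: "fully_idempotent R" and m: "fuzzy_hyperideal R m"
  shows "m = fuzzy_Inter R {e. fuzzy_prime R e \<and> fuzzy_le R m e}" (is "m = fuzzy_Inter R ?F")
proof
  fix a
  note m' = m[THEN fuzzy_hyperideal_fuzzy_subsets]
  note nonempty = exists_fuzzy_prime_above[OF m']
  show "m a = fuzzy_Inter R ?F a"
  proof (cases "a \<in> carrier R")
    case False
    then show ?thesis
      using PiE_arb[OF m'[unfolded fuzzy_subsets_def]] unfolding fuzzy_Inter_def by simp
  next
    case a: True
    have lower: "m a \<le> e a" if "e \<in> ?F" for e using that a unfolding fuzzy_le_def by blast
    have "\<exists>e\<in>?F. e a \<le> m a"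
    proof (cases "m a < 1")
      case True
      have ma: "0 \<le> m a" using fuzzy_subsetsD[OF m' a] by blast
      have "a \<notin> cut R m (m a)" unfolding cut_def by simp
      then obtain P where P: "hyperprime R P" "cut R m (m a) \<subseteq> P" "a \<notin> P"
        using exists_hyperprime_avoiding[OF idem hyperideal_cut[OF m ma True]] by blast
      have "fuzzy_le R m (step_function R P (m a))"
        using P(2) fuzzy_subsetsD[OF m'] unfolding fuzzy_le_def step_function_def cut_def
        by (auto simp: not_less)
      then have "step_function R P (m a) \<in> ?F"
        using fuzzy_prime_step_function[OF P(1) ma True] by blast
      moreover have "step_function R P (m a) a = m a"
        using a P(3) unfolding step_function_def by simp
      ultimately show ?thesis by fastforce
    next
      case False
      obtain e where e: "e \<in> ?F" using nonempty by blast
      then have "e \<in> fuzzy_subsets R"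
        unfolding fuzzy_prime_def using fuzzy_hyperideal_fuzzy_subsets by blast
      then have "e a \<le> m a" using False fuzzy_subsetsD[of e R a] a by linarith
      then show ?thesis using e by blast
    qed
    then obtain e where e: "e \<in> ?F" "e a \<le> m a" by blast
    have "(INF e\<in>?F. e a) \<le> e a"
      using e(1) lower by (intro cINF_lower bdd_belowI[of _ "m a"]) auto
    moreover have "m a \<le> (INF e\<in>?F. e a)"
      using nonempty lower by (intro cINF_greatest)
    ultimately show ?thesis using e(2) a unfolding fuzzy_Inter_def by simp
  qed
qed

text \<open>The characteristic function of \<open>II\<close> is the square of that of \<open>I\<close>, so every fuzzy prime
  above the former is above the latter.\<close>

lemma Inter_fuzzy_primes_imp_fully_idempotent:
  assumes Inter: "\<And>m. fuzzy_hyperideal R m \<Longrightarrow> m = fuzzy_Inter R {e. fuzzy_prime R e \<and> fuzzy_le R m e}"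
  shows "fully_idempotent R"
proof (intro fully_idempotentI subsetI)
  fix I x assume I: "hyperideal R I" and x: "x \<in> I"
  let ?l = "step_function R I 0" and ?m = "step_function R (hyperideal_prod R I I) 0"
  let ?F = "{e. fuzzy_prime R e \<and> fuzzy_le R ?m e}"
  have II: "hyperideal R (hyperideal_prod R I I)" using hyperideal_hyperideal_prod I by blast
  have xc: "x \<in> carrier R" using x I hyperideal_subset_carrier by blast
  have l: "fuzzy_hyperideal R ?l" and m: "fuzzy_hyperideal R ?m"
    using fuzzy_hyperideal_step_function I II by auto
  note sub = l[THEN fuzzy_hyperideal_fuzzy_subsets] m[THEN fuzzy_hyperideal_fuzzy_subsets]
  have "cut R (fuzzy_prod R ?l ?l) t = cut R ?m t" if t: "0 \<le> t" "t < 1" for t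
    using t sub(1) cut_step_function[OF hyperideal_subset_carrier[OF I] t(2), of 0]
      cut_step_function[OF hyperideal_subset_carrier[OF II] t(2), of 0]
    by (simp add: cut_fuzzy_prod)
  then have "fuzzy_prod R ?l ?l = ?m"
    using fuzzy_eq_iff_cuts[OF fuzzy_prod_fuzzy_subsets[OF sub(1,1)] sub(2)] by blast
  then have "fuzzy_le R (fuzzy_prod R ?l ?l) e" if "e \<in> ?F" for e using that by simp
  then have le: "fuzzy_le R ?l e" if "e \<in> ?F" for e
    using that l unfolding fuzzy_prime_def by blast
  have "1 \<le> e x" if "e \<in> ?F" for e
    using le[OF that] x xc unfolding fuzzy_le_def step_function_def by auto
  then have "1 \<le> (INF e\<in>?F. e x)"
    using exists_fuzzy_prime_above[OF sub(2)] by (intro cINF_greatest)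
  also have "\<dots> = ?m x" using fun_cong[OF Inter[OF m], of x] xc unfolding fuzzy_Inter_def by simp
  finally show "x \<in> hyperideal_prod R I I"
    using xc unfolding step_function_def by (auto split: if_splits)
qed

end

section \<open>Characterizations of full idempotency\<close>

theorem theorem3p9:
  fixes R :: "('a, 'b) hyperstructure_scheme"
  assumes "semihyperring R"
  defines "cond1 \<equiv> fully_idempotent R"
    and "cond2 \<equiv>
      distributive_lattice (fuzzy_hyperideal_order R) \<and>
      (\<forall>l m. fuzzy_hyperideal R l \<and> fuzzy_hyperideal R m \<longrightarrow>
         join (fuzzy_hyperideal_order R) l m = fuzzy_sum R l m \<and>
         meet (fuzzy_hyperideal_order R) l m = fuzzy_meet R l m \<and>
         fuzzy_meet R l m = fuzzy_prod R l m)"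
    and "cond3 \<equiv>
      \<forall>m. fuzzy_hyperideal R m \<longrightarrow>
        m = fuzzy_Inter R {e. fuzzy_prime R e \<and> fuzzy_le R m e}"
    and "cond4 \<equiv> hregular R"
  shows "(cond1 \<longleftrightarrow> cond2) \<and> (cond1 \<longleftrightarrow> cond3) \<and> (hcommutative R \<longrightarrow> (cond1 \<longleftrightarrow> cond4))"
proof -
  interpret semihyperring R by (rule assms(1))
  have "cond1 \<longleftrightarrow> cond2"
    unfolding cond1_def cond2_def
    using fully_idempotent_distributive_lattice join_eq_fuzzy_sum meet_eq_fuzzy_meet
      fully_idempotent_fuzzy_meet_eq_prod fuzzy_meet_eq_prod_imp_fully_idempotent by blast
  moreover have "cond1 \<longleftrightarrow> cond3"
    unfolding cond1_def cond3_def
    using fully_idempotent_eq_Inter_fuzzy_primes Inter_fuzzy_primes_imp_fully_idempotent by blast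
  moreover have "hcommutative R \<longrightarrow> (cond1 \<longleftrightarrow> cond4)"
    unfolding cond1_def cond4_def
    using hregular_imp_fully_idempotent fully_idempotent_imp_hregular by blast
  ultimately show ?thesis by blast
qed

end
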